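(* Let $a$ be an indeterminate and let $$ B=\begin{bmatrix} a&1&a&1\\ 1&0&1&a\\ 0&1&a&1\\ 1&a&1&a \end{bmatrix}. $$ Then for all $n\ge1$, $$M(AD_{2n};\mathrm{wt}_B)=(1+a^2)^{n(n+1)}.$$
   Context: For $n\ge0$, the Aztec diamond graph $AD_n$ has vertices $u_{i,j}$ ($0\le i\le n$, $1\le j\le n$) and $v_{i,j}$ ($1\le i\le n$, $0\le j\le n$), and $4n^2$ edges $\epsilon_{r,s}$, $1\le r,s\le 2n$ (the edge centers form a $2n\times2n$ array), where for $1\le i,j\le n$: $\epsilon_{2i-1,2j-1}=u_{i-1,j}v_{i,j-1}$, $\epsilon_{2i-1,2j}=u_{i-1,j}v_{i,j}$, $\epsilon_{2i,2j-1}=u_{i,j}v_{i,j-1}$, $\epsilon_{2i,2j}=u_{i,j}v_{i,j}$. For a $k\times l$ matrix $A$ with $k,l$ even, the weight $\mathrm{wt}_A$ on $AD_n$ assigns to the edge $\epsilon_{r,s}$ the entry of $A$ in row $r'$ and column $s'$, where $1\le r'\le k$, $r'\equiv r \pmod k$, $1\le s'\le l$, $s'\equiv s\pmod l$ (the array of edges is filled periodically with copies of $A$ starting from the upper left corner). The weight of a perfect matching is the product of the weights of its edges, and $M(G;\mathrm{wt})$ is the sum of the weights of all perfect matchings of $G$. *)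

theory Defs
  imports
    "HOL-Computational_Algebra.Polynomial"
    "Jordan_Normal_Form.Matrix"
begin

section \<open>Weighted perfect matchings\<close>

definition perfect_matching :: "'v set \<Rightarrow> 'v set set \<Rightarrow> 'v set set \<Rightarrow> bool" where
  "perfect_matching V E P \<longleftrightarrow> P \<subseteq> E \<and> (\<forall>v\<in>V. \<exists>!e. e \<in> P \<and> v \<in> e)"

definition matching_sum ::
  "'v set \<Rightarrow> 'v set set \<Rightarrow> ('v set \<Rightarrow> 'r::comm_semiring_1) \<Rightarrow> 'r" where
  "matching_sum V E wt = (\<Sum>P | perfect_matching V E P. \<Prod>e\<in>P. wt e)"

section \<open>The Aztec diamond graph\<close>

datatype vertex = U nat nat | V nat nat

definition AD_vertices :: "nat \<Rightarrow> vertex set" where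
  "AD_vertices n =
     {U i j | i j. 0 \<le> i \<and> i \<le> n \<and> 1 \<le> j \<and> j \<le> n} \<union>
     {V i j | i j. 1 \<le> i \<and> i \<le> n \<and> 0 \<le> j \<and> j \<le> n}"

text \<open>The rounding in the indices merges the four parity cases; they are
  listed separately in the lemma \<open>AD_edge_cases\<close>.\<close>

definition AD_edge :: "nat \<Rightarrow> nat \<Rightarrow> vertex set" where
  "AD_edge r s = {U (r div 2) ((s + 1) div 2), V ((r + 1) div 2) (s div 2)}"

lemma AD_edge_cases:
  assumes "1 \<le> i" "1 \<le> j"
  shows "AD_edge (2 * i - 1) (2 * j - 1) = {U (i - 1) j, V i (j - 1)}"
    and "AD_edge (2 * i - 1) (2 * j) = {U (i - 1) j, V i j}"
    and "AD_edge (2 * i) (2 * j - 1) = {U i j, V i (j - 1)}"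
    and "AD_edge (2 * i) (2 * j) = {U i j, V i j}"
proof -
  have "(2 * k - 1) div 2 = k - 1" "(2 * k - 1 + 1) div 2 = k"
      "(2 * k) div 2 = k" "(2 * k + 1) div 2 = k" if "1 \<le> k" for k :: nat
    using that by auto
  with assms show
    "AD_edge (2 * i - 1) (2 * j - 1) = {U (i - 1) j, V i (j - 1)}"
    "AD_edge (2 * i - 1) (2 * j) = {U (i - 1) j, V i j}"
    "AD_edge (2 * i) (2 * j - 1) = {U i j, V i (j - 1)}"
    "AD_edge (2 * i) (2 * j) = {U i j, V i j}"
    unfolding AD_edge_def by simp_all
qed

definition AD_edges :: "nat \<Rightarrow> vertex set set" where
  "AD_edges n = {AD_edge r s | r s. 1 \<le> r \<and> r \<le> 2 * n \<and> 1 \<le> s \<and> s \<le> 2 * n}"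

lemma AD_edge_inject: "AD_edge r s = AD_edge r' s' \<longleftrightarrow> r = r' \<and> s = s'"
proof -
  have *: "a = b" if "a div 2 = b div 2" "(a + 1) div 2 = (b + 1) div 2" for a b :: nat
    using that by presburger
  show ?thesis
    unfolding AD_edge_def by (auto simp: doubleton_eq_iff intro: *)
qed

section \<open>Periodic weights\<close>

text \<open>The edge positions \<open>r\<close>, \<open>s\<close> start from 1, whereas the entries of a
  matrix of type \<open>'r mat\<close> are indexed from 0.\<close>

definition AD_wt :: "'r mat \<Rightarrow> vertex set \<Rightarrow> 'r" where
  "AD_wt A e = (THE x. \<exists>r s. 1 \<le> r \<and> 1 \<le> s \<and> e = AD_edge r s \<and>
     x = A $$ ((r - 1) mod dim_row A, (s - 1) mod dim_col A))"

lemma AD_wt_edge: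
  assumes "1 \<le> r" "1 \<le> s"
  shows "AD_wt A (AD_edge r s) = A $$ ((r - 1) mod dim_row A, (s - 1) mod dim_col A)"
  unfolding AD_wt_def using assms by (intro the_equality) (auto simp: AD_edge_inject)

definition AD_matching_sum :: "nat \<Rightarrow> 'r::comm_semiring_1 mat \<Rightarrow> 'r" where
  "AD_matching_sum n A = matching_sum (AD_vertices n) (AD_edges n) (AD_wt A)"

section \<open>The weight matrix\<close>

definition matB :: "'r::comm_semiring_1 \<Rightarrow> 'r mat" where
  "matB a = mat_of_rows_list 4
     [[a, 1, a, 1],
      [1, 0, 1, a],
      [0, 1, a, 1],
      [1, a, 1, a]]"

end

theory Submission
  imports Defs "HOL-Library.FuncSet" "HOL-Library.Disjoint_Sets"
    "HOL-Computational_Algebra.Polynomial_Factorial"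
begin

text \<open>The edges of \<open>AD\<^sub>m\<close> split into \<open>m\<^sup>2\<close> four-cycles (cells), and every
  vertex lies in one cell or, if it is an interior vertex, in two. Grouping the matchings by
  the cell that covers each vertex turns the matching sum into a sum of products of local
  factors, one per cell. The factor of a cell with weights \<open>x y z t\<close> and covered vertex set \<open>Y\<close>
  equals \<open>\<Delta> = x t + y z\<close> times the factor of the complement of \<open>Y\<close> for the weights
  \<open>t/\<Delta> z/\<Delta> y/\<Delta> x/\<Delta>\<close>. So exchanging, at each interior vertex, the covering cell with the other
  one removes the boundary vertices: what remains is a copy of \<open>AD\<^bsub>m-1\<^esub>\<close> with new
  weights, and the sum gets multiplied by the product of all \<open>\<Delta>\<close>.
  For the given periodic weights, two such reductions lead back to the same weights up to
  rescaling at the vertices \<open>U i j\<close>, which gives the factor \<open>(1 + a\<^sup>2)\<^bsup>2n+2\<^esup>\<close>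
  between \<open>AD\<^bsub>2n\<^esub>\<close> and \<open>AD\<^bsub>2n+2\<^esub>\<close>. Since the reduction divides by \<open>\<Delta>\<close>, it is
  carried out over the field of fractions.\<close>

section \<open>Matchings covering a given vertex set exactly\<close>

text \<open>Edges of \<open>F\<close> may stick out of \<open>X\<close>; they are then simply never
  chosen. So one edge set can be kept while \<open>X\<close> runs over the subsets of a
  cell.\<close>

definition exact_matchings :: "'v set \<Rightarrow> 'v set set \<Rightarrow> 'v set set set" where
  "exact_matchings X F = {Q. Q \<subseteq> F \<and> \<Union>Q = X \<and> pairwise disjnt Q}"

definition exact_sum :: "('v set \<Rightarrow> 'r::comm_semiring_1) \<Rightarrow> 'v set \<Rightarrow> 'v set set \<Rightarrow> 'r" where
  "exact_sum w X F = (\<Sum>Q\<in>exact_matchings X F. \<Prod>e\<in>Q. w e)"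

lemma finite_exact_matchings [simp]: "finite F \<Longrightarrow> finite (exact_matchings X F)"
  by (rule finite_subset[of _ "Pow F"]) (auto simp: exact_matchings_def)

lemma perfect_matching_iff_exact:
  assumes "\<And>e. e \<in> E \<Longrightarrow> e \<subseteq> X"
  shows "perfect_matching X E P \<longleftrightarrow> P \<in> exact_matchings X E"
proof
  assume P: "perfect_matching X E P"
  have "pairwise disjnt P"
  proof (rule pairwiseI)
    fix e f assume ef: "e \<in> P" "f \<in> P" "e \<noteq> f"
    have "v \<notin> f" if "v \<in> e" for v
    proof
      assume "v \<in> f"
      moreover have "v \<in> X" using that ef P assms by (auto simp: perfect_matching_def)
      ultimately show False using P ef that unfolding perfect_matching_def by blast
    qed
    then show "disjnt e f" by (auto simp: disjnt_iff)
  qed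
  with P assms show "P \<in> exact_matchings X E"
    unfolding perfect_matching_def exact_matchings_def by blast
next
  assume P: "P \<in> exact_matchings X E"
  have "\<exists>!e. e \<in> P \<and> v \<in> e" if "v \<in> X" for v
  proof -
    obtain e where e: "e \<in> P" "v \<in> e"
      using P \<open>v \<in> X\<close> unfolding exact_matchings_def by blast
    then show ?thesis
      using P by (intro ex1I[of _ e]) (auto simp: exact_matchings_def pairwise_def disjnt_iff)
  qed
  with P show "perfect_matching X E P"
    by (auto simp: perfect_matching_def exact_matchings_def)
qed

lemma matching_sum_eq_exact_sum:
  assumes "\<And>e. e \<in> E \<Longrightarrow> e \<subseteq> X"
  shows "matching_sum X E w = exact_sum w X E"
  by (simp add: matching_sum_def exact_sum_def perfect_matching_iff_exact[OF assms])

lemma exact_sum_cong: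
  assumes "\<And>e. e \<in> F \<Longrightarrow> w e = w' e"
  shows "exact_sum w X F = exact_sum w' X F"
  unfolding exact_sum_def using assms
  by (intro sum.cong prod.cong) (auto simp: exact_matchings_def)

lemma exact_sum_restrict: "exact_sum w X {e \<in> F. e \<subseteq> X} = exact_sum w X F"
  unfolding exact_sum_def exact_matchings_def by (intro sum.cong) auto

lemma exact_sum_image:
  assumes inj: "inj f"
  shows "exact_sum w (f ` X) ((`) f ` F) = exact_sum (\<lambda>e. w (f ` e)) X F"
proof -
  have ii: "inj ((`) f)" using inj by (simp add: inj_image_eq_iff inj_def)
  have mem: "(`) f ` Q \<in> exact_matchings (f ` X) ((`) f ` F) \<longleftrightarrow> Q \<in> exact_matchings X F" for Q
  proof -
    have "\<Union>((`) f ` Q) = f ` \<Union>Q" by auto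
    then show ?thesis
      using inj by (auto simp: exact_matchings_def pairwise_image disjnt_def image_Int[symmetric]
          inj_image_eq_iff inj_image_subset_iff[OF ii] pairwise_def)
  qed
  have eq: "exact_matchings (f ` X) ((`) f ` F) = (`) ((`) f) ` exact_matchings X F"
  proof
    show "exact_matchings (f ` X) ((`) f ` F) \<subseteq> (`) ((`) f) ` exact_matchings X F"
    proof
      fix P assume P: "P \<in> exact_matchings (f ` X) ((`) f ` F)"
      then obtain Q where "P = (`) f ` Q"
        by (auto simp: exact_matchings_def subset_image_iff)
      with P show "P \<in> (`) ((`) f) ` exact_matchings X F" by (auto simp: mem)
    qed
  qed (auto simp: mem)
  have ij: "inj_on ((`) ((`) f)) A" for A
    using ii by (meson inj_image_eq_iff inj_onI)
  show ?thesis
    unfolding exact_sum_def eq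
    by (subst sum.reindex[OF ij], intro sum.cong refl)
       (simp add: prod.reindex[OF inj_on_subset[OF ii]])
qed

section \<open>Recurrence over edges and the four-cycle\<close>

lemma exact_sum_insert:
  assumes "finite F" "e \<notin> F" "e \<noteq> {}"
  shows "exact_sum w X (insert e F) =
    exact_sum w X F + (if e \<subseteq> X then w e * exact_sum w (X - e) F else 0)"
proof -
  let ?A = "{Q \<in> exact_matchings X (insert e F). e \<in> Q}"
  have split: "exact_matchings X (insert e F) = exact_matchings X F \<union> ?A"
    using assms by (auto simp: exact_matchings_def)
  have "exact_sum w X (insert e F) = exact_sum w X F + (\<Sum>Q\<in>?A. \<Prod>e\<in>Q. w e)"
    unfolding exact_sum_def
    by (subst split, rule sum.union_disjoint)
       (use assms in \<open>auto simp: exact_matchings_def intro: finite_subset[of _ "Pow (insert e F)"]\<close>)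
  also have "(\<Sum>Q\<in>?A. \<Prod>e\<in>Q. w e) = (if e \<subseteq> X then w e * exact_sum w (X - e) F else 0)"
  proof (cases "e \<subseteq> X")
    case True
    have "(\<Sum>Q\<in>?A. \<Prod>e\<in>Q. w e) = (\<Sum>Q\<in>exact_matchings (X - e) F. w e * (\<Prod>e\<in>Q. w e))"
    proof (rule sum.reindex_bij_witness[where i = "insert e" and j = "\<lambda>Q. Q - {e}"])
      fix Q assume Q: "Q \<in> ?A"
      show "insert e (Q - {e}) = Q" using Q by auto
      have "disjnt f e" if "f \<in> Q - {e}" for f
        using that Q by (auto simp: exact_matchings_def pairwise_def)
      then have "\<Union>(Q - {e}) \<inter> e = {}" by (auto simp: disjnt_iff)
      moreover have "\<Union>Q = X" "e \<in> Q" using Q by (auto simp: exact_matchings_def)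
      ultimately have "\<Union>(Q - {e}) = X - e" by blast
      then show "Q - {e} \<in> exact_matchings (X - e) F"
        using Q by (auto simp: exact_matchings_def pairwise_def)
      have "finite Q" using Q assms by (auto simp: exact_matchings_def intro: finite_subset)
      then show "w e * (\<Prod>e\<in>Q - {e}. w e) = (\<Prod>e\<in>Q. w e)"
        using Q by (subst prod.remove[of Q e]) auto
    next
      fix Q assume Q: "Q \<in> exact_matchings (X - e) F"
      then show "insert e Q - {e} = Q" using assms by (auto simp: exact_matchings_def)
      show "insert e Q \<in> ?A"
        using Q True by (auto simp: exact_matchings_def pairwise_insert disjnt_iff)
    qed
    then show ?thesis using True by (simp add: exact_sum_def sum_distrib_left)
  next
    case False
    then have "?A = {}" by (auto simp: exact_matchings_def)
    then show ?thesis unfolding \<open>?A = {}\<close> using False by simp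
  qed
  finally show ?thesis .
qed

lemma exact_sum_empty: "exact_sum w X {} = (if X = {} then 1 else 0)"
proof -
  have "exact_matchings X {} = (if X = {} then {{}} else {})"
    by (auto simp: exact_matchings_def)
  then show ?thesis by (simp add: exact_sum_def)
qed

text \<open>For ten of the 16 subsets \<open>X\<close>, neither \<open>X\<close> nor its complement
  can be matched. The ends of an edge have the ends of the opposite edge as complement, which is
  \<open>dual\<close>. The full and the empty set give the two equations for
  \<open>d\<close>.\<close>

lemma exact_sum_four_cycle_dual:
  fixes w w' :: "'v set \<Rightarrow> 'r::comm_semiring_1"
  assumes dist: "distinct [p, q, r, s]" and X: "X \<subseteq> {p, q, r, s}"
    and dual: "w {p, r} = d * w' {q, s}" "w {p, s} = d * w' {q, r}"
      "w {q, r} = d * w' {p, s}" "w {q, s} = d * w' {p, r}"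
    and d: "d = w {p, r} * w {q, s} + w {p, s} * w {q, r}"
      "d * (w' {p, r} * w' {q, s} + w' {p, s} * w' {q, r}) = 1"
  shows "exact_sum w X {{p, r}, {p, s}, {q, r}, {q, s}} =
    d * exact_sum w' ({p, q, r, s} - X) {{p, r}, {p, s}, {q, r}, {q, s}}"
proof -
  have neq: "p \<noteq> q" "q \<noteq> p" "p \<noteq> r" "r \<noteq> p" "p \<noteq> s" "s \<noteq> p"
    "q \<noteq> r" "r \<noteq> q" "q \<noteq> s" "s \<noteq> q" "r \<noteq> s" "s \<noteq> r"
    using dist by auto
  note eval = exact_sum_insert exact_sum_empty doubleton_eq_iff insert_Diff_if neq
  \<comment> \<open>In this form each of the 16 membership patterns turns \<open>X\<close> into an
    explicit set, on which the edge recurrence evaluates.\<close>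
  have X_eq: "X = (if p \<in> X then {p} else {}) \<union> (if q \<in> X then {q} else {}) \<union>
      (if r \<in> X then {r} else {}) \<union> (if s \<in> X then {s} else {})"
    using X by auto
  \<comment> \<open>Summands in the order in which the edge recurrence produces them.\<close>
  have d': "w {p, s} * w {q, r} + w {p, r} * w {q, s} = d"
    "d * (w' {p, s} * w' {q, r} + w' {p, r} * w' {q, s}) = 1"
    using d by (simp_all add: add.commute)
  show ?thesis
    apply (cases "p \<in> X"; cases "q \<in> X"; cases "r \<in> X"; cases "s \<in> X")
                   apply (use X_eq in \<open>simp_all only: if_True if_False simp_thms Un_empty_left
        Un_empty_right Un_insert_left\<close>)
                   apply (simp_all add: eval)
         apply (rule d' dual)+
    done
qed

section \<open>Decomposition over disjoint edge classes\<close>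

text \<open>\<open>g\<close> records the class that covers each vertex. Once \<open>g\<close> is
  fixed, the choices in different classes are independent, since the edges taken from class
  \<open>c\<close> must cover exactly the fibre of \<open>g\<close> over \<open>c\<close>.\<close>

lemma exact_sum_decompose:
  fixes w :: "'v set \<Rightarrow> 'r::comm_semiring_1"
  assumes "finite C" "finite X" "\<And>c. c \<in> C \<Longrightarrow> finite (F c)"
    and disj: "disjoint_family_on F C"
  shows "exact_sum w X (\<Union>c\<in>C. F c) =
    (\<Sum>g\<in>X \<rightarrow>\<^sub>E C. \<Prod>c\<in>C. exact_sum w {v \<in> X. g v = c} (F c))"
proof -
  let ?M = "\<lambda>g. PiE C (\<lambda>c. exact_matchings {v \<in> X. g v = c} (F c))"
  have "(\<Sum>g\<in>X \<rightarrow>\<^sub>E C. \<Prod>c\<in>C. exact_sum w {v \<in> X. g v = c} (F c)) =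
      (\<Sum>g\<in>X \<rightarrow>\<^sub>E C. \<Sum>Q\<in>?M g. \<Prod>c\<in>C. \<Prod>e\<in>Q c. w e)"
    unfolding exact_sum_def using assms by (intro sum.cong refl prod_sum_PiE) auto
  also have "\<dots> = (\<Sum>(g, Q)\<in>Sigma (X \<rightarrow>\<^sub>E C) ?M. \<Prod>c\<in>C. \<Prod>e\<in>Q c. w e)"
    using assms by (intro sum.Sigma ballI finite_PiE) auto
  also have "\<dots> = exact_sum w X (\<Union>c\<in>C. F c)"
    unfolding exact_sum_def
  \<comment> \<open>A matching corresponds to its covering map together with its parts in the
    classes; the union of the parts is the inverse.\<close>
  proof (rule sum.reindex_bij_witness[where
        i = "\<lambda>P. (\<lambda>v\<in>X. THE c. c \<in> C \<and> v \<in> \<Union>(P \<inter> F c), \<lambda>c\<in>C. P \<inter> F c)"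
        and j = "\<lambda>(g, Q). \<Union>c\<in>C. Q c"])
    fix h assume "h \<in> Sigma (X \<rightarrow>\<^sub>E C) ?M"
    then obtain g Q where h: "h = (g, Q)" and g: "g \<in> X \<rightarrow>\<^sub>E C" and Q: "Q \<in> ?M g"
      by auto
    have Qc: "Q c \<subseteq> F c" "\<Union>(Q c) = {v \<in> X. g v = c}" "pairwise disjnt (Q c)"
      if "c \<in> C" for c
      using PiE_mem[OF Q that] by (auto simp: exact_matchings_def)
    define P where "P = (\<Union>c\<in>C. Q c)"
    have PF: "P \<inter> F c = Q c" if "c \<in> C" for c
    proof -
      have "Q b \<inter> F c = {}" if "b \<in> C" "b \<noteq> c" for b
        using Qc(1)[OF that(1)] disjoint_family_onD[OF disj that(1) \<open>c \<in> C\<close> that(2)] by blast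
      then show ?thesis
        using Qc(1)[OF that] that unfolding P_def by blast
    qed
    have "(THE c. c \<in> C \<and> v \<in> \<Union>(P \<inter> F c)) = g v" if "v \<in> X" for v
    proof (rule the_equality)
      have "g v \<in> C" using g that by auto
      then show "g v \<in> C \<and> v \<in> \<Union>(P \<inter> F (g v))"
        using Qc(2) that by (simp add: PF)
      show "c = g v" if "c \<in> C \<and> v \<in> \<Union>(P \<inter> F c)" for c
        using that Qc(2)[of c] PF[of c] by auto
    qed
    then have "(\<lambda>v\<in>X. THE c. c \<in> C \<and> v \<in> \<Union>(P \<inter> F c)) = g"
      using g by (auto simp: fun_eq_iff PiE_def extensional_def)
    moreover have "(\<lambda>c\<in>C. P \<inter> F c) = Q"
      using Q PF by (auto simp: fun_eq_iff PiE_def extensional_def)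
    ultimately show "(\<lambda>v\<in>X. THE c. c \<in> C \<and> v \<in> \<Union>((case h of (g, Q) \<Rightarrow> \<Union>c\<in>C. Q c) \<inter> F c),
        \<lambda>c\<in>C. (case h of (g, Q) \<Rightarrow> \<Union>c\<in>C. Q c) \<inter> F c) = h"
      by (simp add: h P_def)
    have "pairwise disjnt P"
    proof (rule pairwiseI)
      fix e f assume "e \<in> P" "f \<in> P" "e \<noteq> f"
      then obtain b c where bc: "b \<in> C" "e \<in> Q b" "c \<in> C" "f \<in> Q c" unfolding P_def by auto
      show "disjnt e f"
      proof (cases "b = c")
        case True
        with bc \<open>e \<noteq> f\<close> Qc(3)[of b] show ?thesis by (auto simp: pairwise_def)
      next
        case False
        have "e \<subseteq> {v \<in> X. g v = b}" "f \<subseteq> {v \<in> X. g v = c}"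
          using Union_upper[of e "Q b"] Union_upper[of f "Q c"] bc Qc(2) by simp_all
        with False show ?thesis by (auto simp: disjnt_iff)
      qed
    qed
    moreover have "\<Union>P = X"
    proof -
      have "\<Union>P = (\<Union>c\<in>C. \<Union>(Q c))" by (auto simp: P_def)
      also have "\<dots> = (\<Union>c\<in>C. {v \<in> X. g v = c})" by (simp add: Qc(2))
      also have "\<dots> = X" using g by auto
      finally show ?thesis .
    qed
    moreover have "P \<subseteq> (\<Union>c\<in>C. F c)" using Qc(1) by (auto simp: P_def)
    ultimately show "(case h of (g, Q) \<Rightarrow> \<Union>c\<in>C. Q c) \<in> exact_matchings X (\<Union>c\<in>C. F c)"
      by (simp add: h P_def exact_matchings_def)
    have "finite (Q c)" if "c \<in> C" for c
      using Qc(1) that assms(3) finite_subset by blast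
    then have "(\<Prod>e\<in>P. w e) = (\<Prod>c\<in>C. \<Prod>e\<in>Q c. w e)"
      unfolding P_def using assms(1) Qc(1) disj
      by (intro prod.UNION_disjoint) (blast dest: disjoint_family_onD)+
    then show "(\<Prod>e\<in>(case h of (g, Q) \<Rightarrow> \<Union>c\<in>C. Q c). w e) =
        (case h of (g, Q) \<Rightarrow> \<Prod>c\<in>C. \<Prod>e\<in>Q c. w e)"
      by (simp add: h P_def)
  next
    fix P assume P: "P \<in> exact_matchings X (\<Union>c\<in>C. F c)"
    then have P': "P \<subseteq> (\<Union>c\<in>C. F c)" "\<Union>P = X" "pairwise disjnt P"
      by (auto simp: exact_matchings_def)
    show "(case (\<lambda>v\<in>X. THE c. c \<in> C \<and> v \<in> \<Union>(P \<inter> F c), \<lambda>c\<in>C. P \<inter> F c) of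
        (g, Q) \<Rightarrow> \<Union>c\<in>C. Q c) = P"
      using P' by auto
    let ?g = "\<lambda>v. THE c. c \<in> C \<and> v \<in> \<Union>(P \<inter> F c)"
    \<comment> \<open>Disjointness within \<open>P\<close> leaves one edge at \<open>v\<close>, and
      disjointness of the classes leaves one class for that edge.\<close>
    have unique: "?g v = c" if c: "c \<in> C" "v \<in> \<Union>(P \<inter> F c)" for v c
    proof (rule the_equality)
      fix b assume b: "b \<in> C \<and> v \<in> \<Union>(P \<inter> F b)"
      then obtain e f where ef: "v \<in> e" "e \<in> P" "e \<in> F b" "v \<in> f" "f \<in> P" "f \<in> F c"
        using c by auto
      then have "e = f" using P'(3) by (auto simp: pairwise_def disjnt_iff)
      then show "b = c" using ef b c disjoint_family_onD[OF disj, of b c] by blast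
    qed (use c in simp)
    have g: "?g v \<in> C \<and> v \<in> \<Union>(P \<inter> F (?g v))" if v: "v \<in> X" for v
    proof -
      obtain c where c: "c \<in> C" "v \<in> \<Union>(P \<inter> F c)"
        using P'(1,2) v by blast
      then show ?thesis unfolding unique[OF c] by simp
    qed
    have "\<Union>(P \<inter> F c) = {v \<in> X. (\<lambda>v\<in>X. ?g v) v = c}" if c: "c \<in> C" for c
    proof (intro Set.set_eqI iffI)
      fix v assume v: "v \<in> \<Union>(P \<inter> F c)"
      moreover have "v \<in> X" using v P'(2) by blast
      ultimately show "v \<in> {v \<in> X. (\<lambda>v\<in>X. ?g v) v = c}" using unique c by simp
    next
      fix v assume v: "v \<in> {v \<in> X. (\<lambda>v\<in>X. ?g v) v = c}"
      then show "v \<in> \<Union>(P \<inter> F c)" using g[of v] by auto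
    qed
    then have "P \<inter> F c \<in> exact_matchings {v \<in> X. (\<lambda>v\<in>X. ?g v) v = c} (F c)" if "c \<in> C" for c
      unfolding exact_matchings_def using that P'(3)
      by (intro CollectI conjI) (auto intro: pairwise_subset simp del: restrict_apply)
    then have "(\<lambda>c\<in>C. P \<inter> F c) \<in> ?M (\<lambda>v\<in>X. ?g v)"
      by (intro PiE_I) simp_all
    then show "(\<lambda>v\<in>X. ?g v, \<lambda>c\<in>C. P \<inter> F c) \<in> Sigma (X \<rightarrow>\<^sub>E C) ?M"
      using g by auto
  qed
  finally show ?thesis by simp
qed

section \<open>Complementation in the cells and rescaling at vertices\<close>

lemma exact_sum_eq_0:
  assumes "\<not> X \<subseteq> \<Union>F"
  shows "exact_sum w X F = 0"
proof -
  have "exact_matchings X F = {}" using assms by (auto simp: exact_matchings_def)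
  then show ?thesis by (simp add: exact_sum_def)
qed

text \<open>After the decomposition, \<open>dual\<close> replaces each fibre by its complement in
  the cell. An inner vertex is missing from the fibre of one of its two cells exactly when it is
  assigned to the other, and an outer vertex is never missing from its only cell. The complements
  are thus the fibres of the swapped assignment on \<open>I\<close>.\<close>

lemma exact_sum_reduce:
  fixes w w' :: "'v set \<Rightarrow> 'r::comm_semiring_1"
  assumes fin: "finite C" "\<And>c. c \<in> C \<Longrightarrow> finite (K c)" "\<And>c. c \<in> C \<Longrightarrow> finite (F c)"
    and disj: "disjoint_family_on F C"
    and FK: "\<And>c. c \<in> C \<Longrightarrow> \<Union>(F c) = K c"
    and dual: "\<And>c Y. c \<in> C \<Longrightarrow> Y \<subseteq> K c \<Longrightarrow>
      exact_sum w Y (F c) = d c * exact_sum w' (K c - Y) (F c)"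
    and X: "X = (\<Union>c\<in>C. K c)" and IX: "I \<subseteq> X"
    and inner: "\<And>v. v \<in> I \<Longrightarrow> lo v \<noteq> hi v \<and> {c \<in> C. v \<in> K c} = {lo v, hi v}"
    and outer: "\<And>v. v \<in> X - I \<Longrightarrow> {c \<in> C. v \<in> K c} = {b v}"
  shows "exact_sum w X (\<Union>c\<in>C. F c) = (\<Prod>c\<in>C. d c) * exact_sum w' I (\<Union>c\<in>C. F c)"
proof -
  define cells where "cells v = {c \<in> C. v \<in> K c}" for v
  define other where "other v c = (if c = lo v then hi v else lo v)" for v c
  have finX: "finite X" using fin X by simp
  then have finI: "finite I" using IX by (rule finite_subset[rotated])
  \<comment> \<open>A vertex assigned to a cell that does not contain it makes one factor
    vanish.\<close>
  have restrict: "(\<Sum>g\<in>Y \<rightarrow>\<^sub>E C. \<Prod>c\<in>C. exact_sum u {v \<in> Y. g v = c} (F c)) =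
      (\<Sum>g\<in>PiE Y cells. \<Prod>c\<in>C. exact_sum u {v \<in> Y. g v = c} (F c))"
    if "finite Y" for Y and u :: "'v set \<Rightarrow> 'r"
  proof (rule sum.mono_neutral_right)
    show "\<forall>g\<in>(Y \<rightarrow>\<^sub>E C) - PiE Y cells. (\<Prod>c\<in>C. exact_sum u {v \<in> Y. g v = c} (F c)) = 0"
    proof
      fix g assume g: "g \<in> (Y \<rightarrow>\<^sub>E C) - PiE Y cells"
      then obtain v where v: "v \<in> Y" "g v \<notin> cells v" by (auto simp: PiE_def)
      then have "g v \<in> C" "v \<notin> \<Union>(F (g v))" using g FK by (auto simp: cells_def)
      then have "exact_sum u {y \<in> Y. g y = g v} (F (g v)) = 0"
        using v by (intro exact_sum_eq_0) auto
      with \<open>g v \<in> C\<close> fin(1) show "(\<Prod>c\<in>C. exact_sum u {v \<in> Y. g v = c} (F c)) = 0"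
        by (intro prod_zero) auto
    qed
  qed (use that fin in \<open>auto simp: cells_def intro: finite_PiE\<close>)
  have other: "other v c \<in> cells v" "other v (other v c) = c" "other v c \<noteq> c"
    "b \<in> cells v \<Longrightarrow> b = other v c \<longleftrightarrow> b \<noteq> c"
    if "v \<in> I" "c \<in> cells v" for v c b
    using inner[OF that(1)] that(2) unfolding other_def cells_def[symmetric] by auto
  have outer': "cells v = {b v}" if "v \<in> X - I" for v
    using outer[OF that] by (simp add: cells_def)
  have "exact_sum w X (\<Union>c\<in>C. F c) =
      (\<Sum>g\<in>PiE X cells. \<Prod>c\<in>C. exact_sum w {v \<in> X. g v = c} (F c))"
    using fin finX disj by (simp add: exact_sum_decompose restrict)
  also have "\<dots> = (\<Sum>g\<in>PiE I cells. (\<Prod>c\<in>C. d c) * (\<Prod>c\<in>C. exact_sum w' {v \<in> I. g v = c} (F c)))"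
  \<comment> \<open>Outer vertices have the single admissible value \<open>b v\<close>, so
    restricting to \<open>I\<close> loses nothing; on \<open>I\<close> the swap \<open>other\<close>
    is an involution.\<close>
  proof (rule sum.reindex_bij_witness[where
        j = "\<lambda>g. \<lambda>v\<in>I. other v (g v)" and
        i = "\<lambda>g. \<lambda>v\<in>X. if v \<in> I then other v (g v) else b v"])
    fix g assume g: "g \<in> PiE X cells"
    have gI: "g v \<in> cells v" if "v \<in> I" for v using g that IX by auto
    have gO: "g v = b v" if "v \<in> X - I" for v using g that outer' by auto
    show "(\<lambda>v\<in>X. if v \<in> I then other v ((\<lambda>v\<in>I. other v (g v)) v) else b v) = g"
      using g gI gO other by (auto simp: fun_eq_iff PiE_def extensional_def)
    show "(\<lambda>v\<in>I. other v (g v)) \<in> PiE I cells"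
      using gI other by auto
    have "exact_sum w {v \<in> X. g v = c} (F c) =
        d c * exact_sum w' {v \<in> I. (\<lambda>v\<in>I. other v (g v)) v = c} (F c)" if c: "c \<in> C" for c
    proof -
      have "{v \<in> X. g v = c} \<subseteq> K c" using g by (auto simp: cells_def PiE_def Pi_def)
      moreover have "K c - {v \<in> X. g v = c} = {v \<in> I. (\<lambda>v\<in>I. other v (g v)) v = c}"
      proof (intro Set.set_eqI iffI)
        fix v assume v: "v \<in> K c - {v \<in> X. g v = c}"
        then have vc: "v \<in> X" "c \<in> cells v" "g v \<noteq> c" using c X by (auto simp: cells_def)
        then have "v \<in> I" using outer'[of v] gO[of v] by (metis DiffI singletonD)
        with vc gI other(4)[of v "g v" c] show "v \<in> {v \<in> I. (\<lambda>v\<in>I. other v (g v)) v = c}" by auto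
      next
        fix v assume v: "v \<in> {v \<in> I. (\<lambda>v\<in>I. other v (g v)) v = c}"
        then show "v \<in> K c - {v \<in> X. g v = c}"
          using other(1,3)[of v "g v"] gI[of v] by (auto simp: cells_def)
      qed
      ultimately show ?thesis using dual[OF c] by simp
    qed
    then show "(\<Prod>c\<in>C. d c) * (\<Prod>c\<in>C. exact_sum w' {v \<in> I. (\<lambda>v\<in>I. other v (g v)) v = c} (F c)) =
        (\<Prod>c\<in>C. exact_sum w {v \<in> X. g v = c} (F c))"
      by (simp add: prod.distrib)
  next
    fix g assume g: "g \<in> PiE I cells"
    have "other v (other v (g v)) = g v" if "v \<in> I" for v
      using other(2)[OF that] PiE_mem[OF g that] by simp
    with g show "(\<lambda>v\<in>I. other v ((\<lambda>v\<in>X. if v \<in> I then other v (g v) else b v) v)) = g"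
      using IX by (auto simp: fun_eq_iff PiE_def extensional_def)
    show "(\<lambda>v\<in>X. if v \<in> I then other v (g v) else b v) \<in> PiE X cells"
      using other(1) PiE_mem[OF g] outer' by auto
  qed
  also have "\<dots> = (\<Prod>c\<in>C. d c) * exact_sum w' I (\<Union>c\<in>C. F c)"
    using fin finI disj by (simp add: exact_sum_decompose restrict sum_distrib_left)
  finally show ?thesis .
qed

text \<open>Each vertex of \<open>X\<close> lies in exactly one edge of an exact matching, so every
  matching picks up the same factor.\<close>

lemma exact_sum_gauge:
  fixes w :: "'v set \<Rightarrow> 'r::comm_semiring_1"
  assumes fin: "finite X" "finite F"
  shows "exact_sum (\<lambda>e. w e * (\<Prod>v\<in>e. t v)) X F = exact_sum w X F * (\<Prod>v\<in>X. t v)"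
proof -
  have "(\<Prod>e\<in>Q. \<Prod>v\<in>e. t v) = (\<Prod>v\<in>X. t v)" if "Q \<in> exact_matchings X F" for Q
  proof -
    have Q: "\<Union>Q = X" "pairwise disjnt Q" using that by (auto simp: exact_matchings_def)
    then have "finite e" if "e \<in> Q" for e
      using fin that by (metis Union_upper finite_subset)
    then have "(\<Prod>v\<in>\<Union>Q. t v) = (\<Prod>e\<in>Q. \<Prod>v\<in>e. t v)"
      using Q by (subst prod.Union_disjoint) (auto simp: pairwise_def disjnt_def)
    then show ?thesis using Q by simp
  qed
  then show ?thesis
    unfolding exact_sum_def sum_distrib_right by (simp add: prod.distrib)
qed

section \<open>The cells of the Aztec diamond\<close>

text \<open>The reduction acts on positions in the edge array, so weights are functions of
  \<open>r\<close> and \<open>s\<close>; \<open>AD_edge_inject\<close> makes the transfer to edges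
  well defined.\<close>

definition pos_wt :: "(nat \<Rightarrow> nat \<Rightarrow> 'r) \<Rightarrow> vertex set \<Rightarrow> 'r" where
  "pos_wt w e = (THE x. \<exists>r s. e = AD_edge r s \<and> x = w r s)"

lemma pos_wt_AD_edge [simp]: "pos_wt w (AD_edge r s) = w r s"
  unfolding pos_wt_def by (rule the_equality) (auto simp: AD_edge_inject)

definition AD_sum :: "nat \<Rightarrow> (nat \<Rightarrow> nat \<Rightarrow> 'r::comm_semiring_1) \<Rightarrow> 'r" where
  "AD_sum n w = exact_sum (pos_wt w) (AD_vertices n) (AD_edges n)"

lemma mem_AD_vertices [simp]:
  "U i j \<in> AD_vertices n \<longleftrightarrow> i \<le> n \<and> 1 \<le> j \<and> j \<le> n"
  "V i j \<in> AD_vertices n \<longleftrightarrow> 1 \<le> i \<and> i \<le> n \<and> j \<le> n"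
  by (auto simp: AD_vertices_def)

lemma AD_edge_subset: "e \<in> AD_edges n \<Longrightarrow> e \<subseteq> AD_vertices n"
  unfolding AD_edges_def AD_vertices_def AD_edge_def by auto

lemma AD_matching_sum_eq_AD_sum:
  "AD_matching_sum n A = AD_sum n (\<lambda>r s. A $$ ((r - 1) mod dim_row A, (s - 1) mod dim_col A))"
  unfolding AD_matching_sum_def AD_sum_def
  by (subst matching_sum_eq_exact_sum[OF AD_edge_subset], assumption, rule exact_sum_cong)
     (auto simp: AD_edges_def AD_wt_edge)

lemma AD_sum_cong:
  assumes "\<And>r s. 1 \<le> r \<Longrightarrow> 1 \<le> s \<Longrightarrow> w r s = w' r s"
  shows "AD_sum n w = AD_sum n w'"
  unfolding AD_sum_def using assms by (intro exact_sum_cong) (auto simp: AD_edges_def)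

lemma AD_sum_0 [simp]: "AD_sum 0 w = 1"
  by (simp add: AD_sum_def AD_edges_def AD_vertices_def exact_sum_empty)

text \<open>Cell \<open>(i, j)\<close> carries the block of edges in rows \<open>2 * i + 1\<close>,
  \<open>2 * i + 2\<close> and columns \<open>2 * j + 1\<close>, \<open>2 * j + 2\<close>.\<close>

fun cell_vertices :: "nat \<times> nat \<Rightarrow> vertex set" where
  "cell_vertices (i, j) = {U i (Suc j), U (Suc i) (Suc j), V (Suc i) j, V (Suc i) (Suc j)}"

fun cell_edges :: "nat \<times> nat \<Rightarrow> vertex set set" where
  "cell_edges (i, j) = {{U i (Suc j), V (Suc i) j}, {U i (Suc j), V (Suc i) (Suc j)},
     {U (Suc i) (Suc j), V (Suc i) j}, {U (Suc i) (Suc j), V (Suc i) (Suc j)}}"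

definition cells :: "nat \<Rightarrow> (nat \<times> nat) set" where
  "cells n = {..<n} \<times> {..<n}"

lemma AD_vertices_eq_cells: "AD_vertices n = (\<Union>c\<in>cells n. cell_vertices c)"
proof
  show "AD_vertices n \<subseteq> (\<Union>c\<in>cells n. cell_vertices c)"
  proof
    fix v assume "v \<in> AD_vertices n"
    then consider i j where "v = U i (Suc j)" "i \<le> n" "j < n" | i j where "v = V (Suc i) j" "i < n" "j \<le> n"
      unfolding AD_vertices_def by (auto simp: Suc_le_eq gr0_conv_Suc)
    then show "v \<in> (\<Union>c\<in>cells n. cell_vertices c)"
    proof cases
      case (1 i j)
      then show ?thesis by (cases i) (auto simp: cells_def le_less intro: bexI[of _ "(i, j)"])
    next
      case (2 i j)
      then show ?thesis by (cases j) (auto simp: cells_def le_less intro: bexI[of _ "(i, j)"])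
    qed
  qed
qed (auto simp: cells_def)

lemma AD_edge_cell:
  "AD_edge (Suc (2 * i)) (Suc (2 * j)) = {U i (Suc j), V (Suc i) j}"
  "AD_edge (Suc (2 * i)) (Suc (Suc (2 * j))) = {U i (Suc j), V (Suc i) (Suc j)}"
  "AD_edge (Suc (Suc (2 * i))) (Suc (2 * j)) = {U (Suc i) (Suc j), V (Suc i) j}"
  "AD_edge (Suc (Suc (2 * i))) (Suc (Suc (2 * j))) = {U (Suc i) (Suc j), V (Suc i) (Suc j)}"
  by (simp_all add: AD_edge_def)

lemma pos_wt_cell [simp]:
  "pos_wt w {U i (Suc j), V (Suc i) j} = w (Suc (2 * i)) (Suc (2 * j))"
  "pos_wt w {U i (Suc j), V (Suc i) (Suc j)} = w (Suc (2 * i)) (Suc (Suc (2 * j)))"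
  "pos_wt w {U (Suc i) (Suc j), V (Suc i) j} = w (Suc (Suc (2 * i))) (Suc (2 * j))"
  "pos_wt w {U (Suc i) (Suc j), V (Suc i) (Suc j)} = w (Suc (Suc (2 * i))) (Suc (Suc (2 * j)))"
  by (simp_all flip: AD_edge_cell)

lemma AD_edges_eq_cells: "AD_edges n = (\<Union>c\<in>cells n. cell_edges c)"
proof
  have pos: "\<exists>i<n. r = Suc (2 * i) \<or> r = Suc (Suc (2 * i))" if "1 \<le> r" "r \<le> 2 * n" for r
    using that by presburger
  show "AD_edges n \<subseteq> (\<Union>c\<in>cells n. cell_edges c)"
  proof
    fix e assume "e \<in> AD_edges n"
    then obtain r s where e: "e = AD_edge r s" "1 \<le> r" "r \<le> 2 * n" "1 \<le> s" "s \<le> 2 * n"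
      by (auto simp: AD_edges_def)
    then obtain i j where ij: "i < n" "j < n"
      "r = Suc (2 * i) \<or> r = Suc (Suc (2 * i))" "s = Suc (2 * j) \<or> s = Suc (Suc (2 * j))"
      using pos by meson
    then have "e \<in> cell_edges (i, j)" using e(1) by (auto simp: AD_edge_cell)
    moreover have "(i, j) \<in> cells n" using ij by (simp add: cells_def)
    ultimately show "e \<in> (\<Union>c\<in>cells n. cell_edges c)" by blast
  qed
  have "AD_edge r s \<in> AD_edges n" if "1 \<le> r" "r \<le> 2 * n" "1 \<le> s" "s \<le> 2 * n" for r s
    using that by (auto simp: AD_edges_def)
  then show "(\<Union>c\<in>cells n. cell_edges c) \<subseteq> AD_edges n"
    by (auto simp: cells_def simp flip: AD_edge_cell)
qed

lemma disjoint_family_cell_edges: "disjoint_family_on cell_edges A"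
  unfolding disjoint_family_on_def
proof (intro ballI impI)
  fix c d :: "nat \<times> nat" assume "c \<noteq> d"
  moreover obtain i j k l where "c = (i, j)" "d = (k, l)" by (meson surj_pair)
  ultimately show "cell_edges c \<inter> cell_edges d = {}" by (auto simp: doubleton_eq_iff)
qed

text \<open>Cells are indexed from 0, edge positions from 1.\<close>

definition cell_det :: "(nat \<Rightarrow> nat \<Rightarrow> 'r::comm_semiring_1) \<Rightarrow> nat \<Rightarrow> nat \<Rightarrow> 'r" where
  "cell_det w i j =
     w (Suc (2 * i)) (Suc (2 * j)) * w (Suc (Suc (2 * i))) (Suc (Suc (2 * j))) +
     w (Suc (2 * i)) (Suc (Suc (2 * j))) * w (Suc (Suc (2 * i))) (Suc (2 * j))"

section \<open>Dual weights and the passage to the interior\<close>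

text \<open>Applied to both row and column, this exchange within a block sends an edge to the
  opposite edge of its cell.\<close>

definition flip_pos :: "nat \<Rightarrow> nat" where
  "flip_pos r = (if odd r then r + 1 else r - 1)"

text \<open>The weight change of urban renewal; \<open>(r - 1) div 2\<close> converts a position to
  the index of its cell.\<close>

definition dual_wt :: "(nat \<Rightarrow> nat \<Rightarrow> 'r::field) \<Rightarrow> nat \<Rightarrow> nat \<Rightarrow> 'r" where
  "dual_wt w r s = w (flip_pos r) (flip_pos s) / cell_det w ((r - 1) div 2) ((s - 1) div 2)"

lemma exact_sum_cell_dual:
  assumes det: "cell_det w i j \<noteq> 0" and X: "X \<subseteq> cell_vertices (i, j)"
  shows "exact_sum (pos_wt w) X (cell_edges (i, j)) =
    cell_det w i j * exact_sum (pos_wt (dual_wt w)) (cell_vertices (i, j) - X) (cell_edges (i, j))"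
  unfolding cell_edges.simps cell_vertices.simps
proof (rule exact_sum_four_cycle_dual)
  let ?d = "cell_det w i j"
  \<comment> \<open>The dual weights have determinant \<open>1 / ?d\<close>: two factors
    \<open>1 / ?d\<close> against one \<open>?d\<close> from the numerators.\<close>
  have "?d * (w (Suc (Suc (2*i))) (Suc (Suc (2*j))) / ?d * (w (Suc (2*i)) (Suc (2*j)) / ?d) +
     w (Suc (Suc (2*i))) (Suc (2*j)) / ?d * (w (Suc (2*i)) (Suc (Suc (2*j))) / ?d)) = ?d * ?d / (?d * ?d)"
    using det by (simp add: field_simps) (simp add: cell_det_def algebra_simps)
  then show "?d * (pos_wt (dual_wt w) {U i (Suc j), V (Suc i) j} *
      pos_wt (dual_wt w) {U (Suc i) (Suc j), V (Suc i) (Suc j)} +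
     pos_wt (dual_wt w) {U i (Suc j), V (Suc i) (Suc j)} *
      pos_wt (dual_wt w) {U (Suc i) (Suc j), V (Suc i) j}) = 1"
    using det by (simp add: dual_wt_def flip_pos_def)
qed (use det X in \<open>simp_all add: dual_wt_def flip_pos_def cell_det_def\<close>)

text \<open>The interior of an Aztec diamond is a smaller one with the roles of the two
  vertex classes exchanged.\<close>

fun shift :: "vertex \<Rightarrow> vertex" where
  "shift (U i j) = V (Suc i) j"
| "shift (V i j) = U i (Suc j)"

lemma inj_shift: "inj shift"
proof
  fix v v' assume "shift v = shift v'"
  then show "v = v'" by (cases v; cases v') auto
qed

text \<open>Hence the array of the smaller diamond sits one row down and one column to the right,
  which is the source of \<open>Suc\<close> in the reduced weights.\<close>

lemma shift_AD_edge: "shift ` AD_edge r s = AD_edge (Suc r) (Suc s)"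
  by (auto simp: AD_edge_def)

lemma mem_shift_AD_vertices:
  "U i j \<in> shift ` AD_vertices m \<longleftrightarrow> 1 \<le> i \<and> i \<le> m \<and> 1 \<le> j \<and> j \<le> Suc m"
  "V i j \<in> shift ` AD_vertices m \<longleftrightarrow> 1 \<le> i \<and> i \<le> Suc m \<and> 1 \<le> j \<and> j \<le> m"
proof -
  have "U i 0 \<noteq> shift v" "V 0 j \<noteq> shift v" for v
    by (cases v; simp)+
  then have "U i 0 \<notin> shift ` AD_vertices m" "V 0 j \<notin> shift ` AD_vertices m"
    by blast+
  moreover have "U i (Suc k) \<in> shift ` AD_vertices m \<longleftrightarrow> V i k \<in> AD_vertices m"
    "V (Suc k) j \<in> shift ` AD_vertices m \<longleftrightarrow> U k j \<in> AD_vertices m" for k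
    using inj_image_mem_iff[OF inj_shift, of "V i k"] inj_image_mem_iff[OF inj_shift, of "U k j"]
    by simp_all
  ultimately show "U i j \<in> shift ` AD_vertices m \<longleftrightarrow> 1 \<le> i \<and> i \<le> m \<and> 1 \<le> j \<and> j \<le> Suc m"
    by (cases j) auto
  show "V i j \<in> shift ` AD_vertices m \<longleftrightarrow> 1 \<le> i \<and> i \<le> Suc m \<and> 1 \<le> j \<and> j \<le> m"
    using \<open>V 0 j \<notin> shift ` AD_vertices m\<close>
      \<open>\<And>k. V (Suc k) j \<in> shift ` AD_vertices m \<longleftrightarrow> U k j \<in> AD_vertices m\<close>
    by (cases i) auto
qed

text \<open>Both ends are interior exactly when \<open>r div 2\<close> and \<open>s div 2\<close>
  lie between 1 and \<open>m\<close>, that is, for positions from 2 to \<open>2 * m + 1\<close>; the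
  outermost rows and columns drop out.\<close>

lemma inner_AD_edges:
  "{e \<in> AD_edges (Suc m). e \<subseteq> shift ` AD_vertices m} = (`) shift ` AD_edges m"
proof (intro Set.set_eqI iffI)
  fix e assume "e \<in> {e \<in> AD_edges (Suc m). e \<subseteq> shift ` AD_vertices m}"
  then obtain r s where e: "e = AD_edge r s" and "AD_edge r s \<subseteq> shift ` AD_vertices m"
    by (auto simp: AD_edges_def)
  then have "1 \<le> r div 2" "r div 2 \<le> m" "1 \<le> s div 2" "s div 2 \<le> m"
    by (auto simp: AD_edge_def mem_shift_AD_vertices)
  then have "2 \<le> r" "r \<le> 2 * m + 1" "2 \<le> s" "s \<le> 2 * m + 1" by linarith+
  then have "e = shift ` AD_edge (r - 1) (s - 1)" "AD_edge (r - 1) (s - 1) \<in> AD_edges m"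
    unfolding AD_edges_def by (auto simp: e shift_AD_edge simp del: One_nat_def
        intro: exI[of _ "r - 1", OF exI[of _ "s - 1"]])
  then show "e \<in> (`) shift ` AD_edges m" by blast
next
  fix e assume e: "e \<in> (`) shift ` AD_edges m"
  then have "e \<subseteq> shift ` AD_vertices m" using AD_edge_subset by auto
  moreover have "e \<in> AD_edges (Suc m)"
    using e by (auto simp: AD_edges_def shift_AD_edge AD_edge_inject)
  ultimately show "e \<in> {e \<in> AD_edges (Suc m). e \<subseteq> shift ` AD_vertices m}" by simp
qed

lemma AD_sum_reduce:
  fixes w :: "nat \<Rightarrow> nat \<Rightarrow> 'r::field"
  assumes det: "\<And>i j. i \<le> m \<Longrightarrow> j \<le> m \<Longrightarrow> cell_det w i j \<noteq> 0"
  shows "AD_sum (Suc m) w = (\<Prod>i<Suc m. \<Prod>j<Suc m. cell_det w i j) *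
    AD_sum m (\<lambda>r s. dual_wt w (Suc r) (Suc s))"
proof -
  let ?C = "cells (Suc m)" and ?I = "shift ` AD_vertices m"
  \<comment> \<open>The two cells at an interior vertex: those at \<open>U i j\<close> differ in the
    first index, those at \<open>V i j\<close> in the second.\<close>
  define lo where "lo v = (case v of U i j \<Rightarrow> (i - 1, j - 1) | V i j \<Rightarrow> (i - 1, j - 1))" for v
  define hi where "hi v = (case v of U i j \<Rightarrow> (i, j - 1) | V i j \<Rightarrow> (i - 1, j))" for v
  have "AD_sum (Suc m) w = exact_sum (pos_wt w) (AD_vertices (Suc m)) (\<Union>c\<in>?C. cell_edges c)"
    by (simp add: AD_sum_def AD_edges_eq_cells)
  also have "\<dots> = (\<Prod>c\<in>?C. case c of (i, j) \<Rightarrow> cell_det w i j) *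
      exact_sum (pos_wt (dual_wt w)) ?I (\<Union>c\<in>?C. cell_edges c)"
  \<comment> \<open>On the boundary \<open>lo\<close> is the only cell: truncated subtraction sends
    index 0 to cell 0, and at the far side \<open>hi\<close> falls outside
    \<open>?C\<close>.\<close>
  proof (rule exact_sum_reduce[where K = cell_vertices and lo = lo and hi = hi and b = lo])
    show "exact_sum (pos_wt w) Y (cell_edges c) = (case c of (i, j) \<Rightarrow> cell_det w i j) *
        exact_sum (pos_wt (dual_wt w)) (cell_vertices c - Y) (cell_edges c)"
      if "c \<in> ?C" "Y \<subseteq> cell_vertices c" for c Y
    proof -
      obtain i j where c: "c = (i, j)" by (meson surj_pair)
      with that have "cell_det w i j \<noteq> 0" by (simp add: det cells_def)
      with that show ?thesis unfolding c prod.case by (intro exact_sum_cell_dual)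
    qed
    show "lo v \<noteq> hi v \<and> {c \<in> ?C. v \<in> cell_vertices c} = {lo v, hi v}" if "v \<in> ?I" for v
      using that by (cases v) (auto simp: mem_shift_AD_vertices cells_def lo_def hi_def)
    show "{c \<in> ?C. v \<in> cell_vertices c} = {lo v}" if "v \<in> AD_vertices (Suc m) - ?I" for v
      using that by (cases v) (auto simp: mem_shift_AD_vertices cells_def lo_def)
    show "?I \<subseteq> AD_vertices (Suc m)"
    proof
      fix v assume "v \<in> ?I"
      then show "v \<in> AD_vertices (Suc m)" by (cases v) (auto simp: mem_shift_AD_vertices)
    qed
  qed (auto simp: AD_vertices_eq_cells disjoint_family_cell_edges cells_def)
  also have "exact_sum (pos_wt (dual_wt w)) ?I (\<Union>c\<in>?C. cell_edges c) =
      exact_sum (pos_wt (dual_wt w)) ?I ((`) shift ` AD_edges m)"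
    by (simp flip: AD_edges_eq_cells inner_AD_edges add: exact_sum_restrict)
  also have "\<dots> = AD_sum m (\<lambda>r s. dual_wt w (Suc r) (Suc s))"
    unfolding exact_sum_image[OF inj_shift] AD_sum_def
    by (rule exact_sum_cong) (auto simp: AD_edges_def shift_AD_edge)
  also have "(\<Prod>c\<in>?C. case c of (i, j) \<Rightarrow> cell_det w i j) = (\<Prod>i<Suc m. \<Prod>j<Suc m. cell_det w i j)"
    unfolding cells_def by (simp only: prod.cartesian_product)
  finally show ?thesis .
qed

text \<open>\<open>r div 2\<close> and \<open>(s + 1) div 2\<close> are the indices of the
  \<open>U\<close> end of \<open>AD_edge r s\<close>, so only the \<open>U\<close> vertices are
  rescaled.\<close>

lemma AD_sum_gauge:
  "AD_sum n (\<lambda>r s. w r s * t (r div 2) ((s + 1) div 2)) =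
    AD_sum n w * (\<Prod>i\<le>n. \<Prod>j=1..n. t i j)"
proof -
  define t' where "t' v = (case v of U i j \<Rightarrow> t i j | V i j \<Rightarrow> 1)" for v
  have fin: "finite (AD_vertices n)" "finite (AD_edges n)"
    by (auto simp: AD_vertices_eq_cells AD_edges_eq_cells cells_def)
  have "AD_sum n (\<lambda>r s. w r s * t (r div 2) ((s + 1) div 2)) =
      exact_sum (\<lambda>e. pos_wt w e * (\<Prod>v\<in>e. t' v)) (AD_vertices n) (AD_edges n)"
    unfolding AD_sum_def
    by (rule exact_sum_cong) (auto simp: AD_edges_def, simp add: AD_edge_def t'_def)
  also have "\<dots> = AD_sum n w * (\<Prod>v\<in>AD_vertices n. t' v)"
    by (simp add: exact_sum_gauge fin AD_sum_def)
  also have "(\<Prod>v\<in>AD_vertices n. t' v) = (\<Prod>v\<in>(\<lambda>(i, j). U i j) ` ({..n} \<times> {1..n}). t' v)"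
    by (rule prod.mono_neutral_right[OF fin(1)])
       (auto simp: AD_vertices_def t'_def split: vertex.split)
  also have "\<dots> = (\<Prod>(i, j)\<in>{..n} \<times> {1..n}. t i j)"
    by (subst prod.reindex) (auto simp: inj_on_def t'_def intro!: prod.cong)
  finally show ?thesis by (simp add: prod.cartesian_product)
qed

section \<open>The periodic weights\<close>

definition periodic :: "'r list list \<Rightarrow> nat \<Rightarrow> nat \<Rightarrow> 'r" where
  "periodic M r s = M ! ((r - 1) mod 4) ! ((s - 1) mod 4)"

definition rowsB :: "'r::field \<Rightarrow> 'r list list" where
  "rowsB a = [[a, 1, a, 1], [1, 0, 1, a], [0, 1, a, 1], [1, a, 1, a]]"

text \<open>The weights after one reduction of \<open>rowsB\<close>; \<open>d\<close> is the
  determinant of the cells with odd second index.\<close>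

definition rowsB1 :: "'r::field \<Rightarrow> 'r list list" where
  "rowsB1 a = (let d = 1 + a ^ 2 in
     [[a, 1 / d, a / d, 1], [1, a / d, 1 / d, a], [0, 1 / d, a / d, 1], [1, a / d, 1 / d, 0]])"

text \<open>The weights after the second reduction, equal to \<open>rowsB\<close> up to factors at
  the \<open>U\<close> vertices.\<close>

definition rowsB2 :: "'r::field \<Rightarrow> 'r list list" where
  "rowsB2 a = (let d = 1 + a ^ 2 in
     [[a, 1, a / d, 1 / d], [d, 0, 1, a], [0, d, a, 1], [1, a, 1 / d, a / d]])"

lemma mod_4_simps:
  "4 * k mod 4 = 0" "Suc (4 * k) mod 4 = 1" "Suc (Suc (4 * k)) mod 4 = 2" "Suc (Suc (Suc (4 * k))) mod 4 = 3"
  "Suc (Suc (Suc (Suc (4 * k)))) mod 4 = 0" "Suc (Suc (Suc (Suc (Suc (4 * k))))) mod 4 = 1" for k :: nat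
  by presburger+

lemma div_2_simps:
  "4 * k div 2 = 2 * k" "Suc (4 * k) div 2 = 2 * k" "Suc (Suc (4 * k)) div 2 = 2 * k + 1"
  "Suc (Suc (Suc (4 * k))) div 2 = 2 * k + 1" "Suc (Suc (Suc (Suc (4 * k)))) div 2 = 2 * k + 2" for k :: nat
  by presburger+

lemma nat_mod_4_cases:
  fixes r :: nat
  assumes "1 \<le> r"
  obtains k where "r = Suc (4 * k)" | k where "r = Suc (Suc (4 * k))"
    | k where "r = Suc (Suc (Suc (4 * k)))" | k where "r = Suc (Suc (Suc (Suc (4 * k))))"
proof -
  have "\<exists>k. r = Suc (4 * k) \<or> r = Suc (Suc (4 * k)) \<or> r = Suc (Suc (Suc (4 * k))) \<or>
      r = Suc (Suc (Suc (Suc (4 * k))))"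
    using assms by presburger
  with that show ?thesis by blast
qed

lemma cell_det_periodic:
  "cell_det (periodic M) i j = cell_det (periodic M) (if odd i then 1 else 0) (if odd j then 1 else 0)"
proof -
  have "2 * i mod 4 = (if odd i then 2 else 0)" "Suc (2 * i) mod 4 = (if odd i then 3 else 1)" for i :: nat
    by (cases "odd i"; simp; presburger)+
  then show ?thesis by (simp add: cell_det_def periodic_def)
qed

lemma cell_det_rowsB:
  "cell_det (periodic (rowsB a)) i j = (if odd j then 1 + a ^ 2 else 1)"
  unfolding cell_det_periodic[of _ i j]
  by (simp add: cell_det_def periodic_def rowsB_def power2_eq_square algebra_simps)

lemma cell_det_rowsB1:
  assumes "1 + a ^ 2 \<noteq> 0"
  shows "cell_det (periodic (rowsB1 a)) i j = (if odd i then 1 / (1 + a ^ 2) else 1)"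
proof -
  have "a * a / (1 + a * a) + 1 / (1 + a * a) = 1" "1 / (1 + a * a) + a * a / (1 + a * a) = 1"
    using assms by (simp_all add: add_divide_distrib[symmetric] power2_eq_square add.commute)
  then show ?thesis
    unfolding cell_det_periodic[of _ i j]
    by (simp add: cell_det_def periodic_def rowsB1_def Let_def power2_eq_square)
qed

text \<open>Both sides have period 4 in each index, so sixteen pairs of residues suffice.\<close>

lemma dual_rowsB:
  assumes "1 + a ^ 2 \<noteq> 0" "1 \<le> r" "1 \<le> s"
  shows "dual_wt (periodic (rowsB a)) (Suc r) (Suc s) = periodic (rowsB1 a) r s"
  using assms(1)
  by (cases rule: nat_mod_4_cases[OF assms(2)]; cases rule: nat_mod_4_cases[OF assms(3)])
     (simp_all add: dual_wt_def cell_det_rowsB flip_pos_def div_2_simps,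
      simp_all add: periodic_def mod_4_simps rowsB_def rowsB1_def Let_def)

lemma dual_rowsB1:
  assumes "1 + a ^ 2 \<noteq> 0" "1 \<le> r" "1 \<le> s"
  shows "dual_wt (periodic (rowsB1 a)) (Suc r) (Suc s) = periodic (rowsB2 a) r s"
  using assms(1)
  by (cases rule: nat_mod_4_cases[OF assms(2)]; cases rule: nat_mod_4_cases[OF assms(3)])
     (simp_all add: dual_wt_def cell_det_rowsB1[OF assms(1)] flip_pos_def div_2_simps,
      simp_all add: periodic_def mod_4_simps rowsB1_def rowsB2_def Let_def)

text \<open>Read off by comparing \<open>rowsB2\<close> with \<open>rowsB\<close>: the second and
  third rows carry an extra \<open>d\<close>, the third and fourth columns an extra
  \<open>1 / d\<close>.\<close>

definition gauge :: "'r::field \<Rightarrow> nat \<Rightarrow> nat \<Rightarrow> 'r" where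
  "gauge d i j = (if odd i then d else 1) * (if even j then 1 / d else 1)"

lemma rowsB2_gauge:
  assumes "1 + a ^ 2 \<noteq> 0" "1 \<le> r" "1 \<le> s"
  shows "periodic (rowsB2 a) r s = periodic (rowsB a) r s * gauge (1 + a ^ 2) (r div 2) ((s + 1) div 2)"
  using assms(1)
  by (cases rule: nat_mod_4_cases[OF assms(2)]; cases rule: nat_mod_4_cases[OF assms(3)])
     (simp_all add: gauge_def periodic_def div_2_simps mod_4_simps
        rowsB_def rowsB2_def Let_def)

text \<open>There are \<open>n\<close> odd \<open>i\<close> with \<open>2 * n\<close> columns each
  and \<open>n\<close> even \<open>j\<close> with \<open>2 * n + 1\<close> rows each, so the
  exponent of \<open>d\<close> is \<open>2 * n * n - n * (2 * n + 1) = - n\<close>.\<close>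

lemma prod_gauge:
  assumes "d \<noteq> 0"
  shows "(\<Prod>i\<le>2 * n. \<Prod>j=1..2 * n. gauge d i j) * d ^ n = 1"
proof -
  have odd: "(\<Prod>i\<le>2 * n. if odd i then x else 1) = x ^ n" for x :: 'a and n
    by (induction n) simp_all
  have even: "(\<Prod>j=1..2 * n. if even j then x else 1) = x ^ n" for x :: 'a and n
    by (induction n) simp_all
  have "(\<Prod>j=1..2 * n. gauge d i j) = (if odd i then d else 1) ^ (2 * n) * (1 / d) ^ n" for i
    unfolding gauge_def prod.distrib even by simp
  then have "(\<Prod>i\<le>2 * n. \<Prod>j=1..2 * n. gauge d i j) =
      (\<Prod>i\<le>2 * n. if odd i then d else 1) ^ (2 * n) * ((1 / d) ^ n) ^ Suc (2 * n)"
    by (simp add: prod.distrib prod_power_distrib)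
  also have "\<dots> = (1 / d) ^ n"
    unfolding odd using assms by (simp add: power_divide field_simps flip: power_mult)
  finally show ?thesis using assms by (simp add: power_divide)
qed

text \<open>An induction step consists of two reductions and a rescaling. They contribute the
  exponents \<open>2 * (n + 1) ^ 2\<close>, \<open>- n * (2 * n + 1)\<close> and \<open>- n\<close>
  of \<open>1 + a ^ 2\<close>, in total \<open>2 * n + 2\<close>.\<close>

lemma AD_sum_rowsB:
  fixes a :: "'r::field"
  assumes d: "1 + a ^ 2 \<noteq> 0"
  shows "AD_sum (2 * n) (periodic (rowsB a)) = (1 + a ^ 2) ^ (n * (n + 1))"
proof (induction n)
  case (Suc n)
  let ?d = "1 + a ^ 2" and ?g = "\<Prod>i\<le>2 * n. \<Prod>j=1..2 * n. gauge (1 + a ^ 2) i j"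
  have odd_even: "(\<Prod>j<2 * n. if odd j then x else 1) = x ^ n" for x :: 'r and n
    by (induction n) simp_all
  have powers: "(x ^ Suc n) ^ (2 * Suc n) * (((1 / x) ^ n) ^ Suc (2 * n) * (x ^ (n * (n + 1)) * (1 / x ^ n))) =
      x ^ (Suc n * (Suc n + 1))" if "x \<noteq> 0" for x :: 'r
    using that by (simp add: power_divide field_simps flip: power_mult power_add)
  have two_Suc: "Suc (Suc (2 * n)) = 2 * Suc n" by simp
  have P0: "(\<Prod>i<Suc (Suc (2 * n)). \<Prod>j<Suc (Suc (2 * n)). cell_det (periodic (rowsB a)) i j) =
      (?d ^ Suc n) ^ (2 * Suc n)"
    unfolding two_Suc cell_det_rowsB odd_even by (simp only: prod_constant card_lessThan)
  have "(\<Prod>i<Suc (2 * n). \<Prod>j<Suc (2 * n). cell_det (periodic (rowsB1 a)) i j) =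
      (\<Prod>i<Suc (2 * n). if odd i then 1 / ?d else 1) ^ Suc (2 * n)"
    unfolding cell_det_rowsB1[OF d] by (simp only: prod_constant card_lessThan prod_power_distrib)
  \<comment> \<open>The extra index \<open>2 * n\<close> is even and contributes 1.\<close>
  also have "\<dots> = ((1 / ?d) ^ n) ^ Suc (2 * n)"
    using odd_even[where n = n and x = "1 / ?d"] by simp
  finally have P1: "(\<Prod>i<Suc (2 * n). \<Prod>j<Suc (2 * n). cell_det (periodic (rowsB1 a)) i j) =
    ((1 / ?d) ^ n) ^ Suc (2 * n)" .
  have "AD_sum (Suc (Suc (2 * n))) (periodic (rowsB a)) =
      (?d ^ Suc n) ^ (2 * Suc n) * AD_sum (Suc (2 * n)) (periodic (rowsB1 a))"
    by (subst AD_sum_reduce, simp add: cell_det_rowsB d, subst AD_sum_cong[OF dual_rowsB[OF d]])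
       (simp_all only: P0)
  also have "AD_sum (Suc (2 * n)) (periodic (rowsB1 a)) =
      ((1 / ?d) ^ n) ^ Suc (2 * n) * AD_sum (2 * n) (periodic (rowsB2 a))"
    by (subst AD_sum_reduce, simp add: cell_det_rowsB1 d, subst AD_sum_cong[OF dual_rowsB1[OF d]])
       (simp_all only: P1)
  also have "AD_sum (2 * n) (periodic (rowsB2 a)) = AD_sum (2 * n) (periodic (rowsB a)) * ?g"
    by (subst AD_sum_cong[OF rowsB2_gauge[OF d]]) (simp_all only: AD_sum_gauge)
  also have "\<dots> = ?d ^ (n * (n + 1)) * (1 / ?d ^ n)"
    using prod_gauge[OF d, of n] Suc d by (simp add: field_simps)
  finally have "AD_sum (2 * Suc n) (periodic (rowsB a)) =
      (?d ^ Suc n) ^ (2 * Suc n) * (((1 / ?d) ^ n) ^ Suc (2 * n) * (?d ^ (n * (n + 1)) * (1 / ?d ^ n)))"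
    by simp
  also have "\<dots> = ?d ^ (Suc n * (Suc n + 1))"
    using d by (rule powers)
  finally show ?case .
qed simp

section \<open>Passage from polynomials to their fractions\<close>

lemma to_fract_sum: "to_fract (\<Sum>x\<in>A. f x) = (\<Sum>x\<in>A. to_fract (f x))"
  by (induction A rule: infinite_finite_induct) simp_all

lemma to_fract_prod: "to_fract (\<Prod>x\<in>A. f x) = (\<Prod>x\<in>A. to_fract (f x))"
  by (induction A rule: infinite_finite_induct) simp_all

lemma to_fract_power: "to_fract (x ^ n) = to_fract x ^ n"
  by (induction n) simp_all

lemma to_fract_AD_sum: "to_fract (AD_sum n w) = AD_sum n (\<lambda>r s. to_fract (w r s))"
proof -
  have "to_fract (AD_sum n w) = exact_sum (\<lambda>e. to_fract (pos_wt w e)) (AD_vertices n) (AD_edges n)"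
    by (simp add: AD_sum_def exact_sum_def to_fract_sum to_fract_prod)
  also have "\<dots> = AD_sum n (\<lambda>r s. to_fract (w r s))"
    unfolding AD_sum_def by (rule exact_sum_cong) (auto simp: AD_edges_def)
  finally show ?thesis .
qed

lemma to_fract_matB:
  "to_fract (matB a $$ ((r - 1) mod dim_row (matB a), (s - 1) mod dim_col (matB a))) =
    periodic (rowsB (to_fract a)) r s"
proof -
  have "dim_row (matB a) = 4" "dim_col (matB a) = 4"
    by (simp_all add: matB_def mat_of_rows_list_def)
  moreover have "(r - 1) mod 4 < 4" "(s - 1) mod 4 < 4" by simp_all
  moreover have "to_fract (matB a $$ (i, j)) = rowsB (to_fract a) ! i ! j" if "i < 4" "j < 4" for i j
  proof -
    have "i \<in> {0, 1, 2, 3}" "j \<in> {0, 1, 2, 3}" using that by auto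
    then show ?thesis
      by (auto simp: matB_def mat_of_rows_list_def rowsB_def)
  qed
  ultimately show ?thesis by (simp add: periodic_def)
qed

theorem theorem7p1:
  fixes a :: "int poly" and n :: nat
  assumes "a = [:0, 1:]" and "n \<ge> 1"
  shows "AD_matching_sum (2 * n) (matB a) = (1 + a ^ 2) ^ (n * (n + 1))"
proof -
  \<comment> \<open>All cell determinants that occur are 1, \<open>1 + a ^ 2\<close> or its inverse,
    so this is the only nonvanishing condition.\<close>
  have "1 + a ^ 2 \<noteq> 0"
    using assms(1) by (simp add: power2_eq_square one_pCons)
  then have "to_fract (1 + a ^ 2) \<noteq> 0" by (simp only: to_fract_eq_0_iff not_False_eq_True)
  then have d: "1 + to_fract a ^ 2 \<noteq> 0" by (simp only: to_fract_power to_fract_add to_fract_1 not_False_eq_True)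
  have "to_fract (AD_matching_sum (2 * n) (matB a)) = AD_sum (2 * n) (periodic (rowsB (to_fract a)))"
    by (simp only: AD_matching_sum_eq_AD_sum to_fract_AD_sum to_fract_matB)
  also have "\<dots> = to_fract ((1 + a ^ 2) ^ (n * (n + 1)))"
    by (simp only: AD_sum_rowsB[OF d] to_fract_power to_fract_add to_fract_1)
  finally show ?thesis by (simp only: to_fract_eq_iff)
qed

end
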